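(* Every infinite group $G$ admits an inverse ambiguous function; that is, for every infinite group $G$ there exists a bijection $f\colon G\to G$ such that $f^{-1}(x)=f(x)^{-1}$ for every $x\in G$.
   Context: Let $G$ be a group. A bijection $f\colon G\to G$ is called an inverse ambiguous function if $f^{-1}(x)=f(x)^{-1}$ for every $x\in G$, where $f^{-1}(x)$ denotes the preimage of $x$ under $f$ and $f(x)^{-1}$ denotes the inverse of the element $f(x)$ in $G$. The function $f$ is not required to be a homomorphism. *)

theory Defs
  imports "HOL-Algebra.Group"
begin

(* The preimage of x under the bijection f of the carrier is inv_into (carrier G) f x;
   inv\<^bsub>G\<^esub> is the inverse in the group. Only the values of f on carrier G matter. *)
definition inverse_ambiguous :: "('a, 'b) monoid_scheme \<Rightarrow> ('a \<Rightarrow> 'a) \<Rightarrow> bool" where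
  "inverse_ambiguous G f \<longleftrightarrow>
     bij_betw f (carrier G) (carrier G) \<and>
     (\<forall>x \<in> carrier G. inv_into (carrier G) f x = inv\<^bsub>G\<^esub> (f x))"

end

(* Inverse ambiguous functions correspond to square roots h of the inversion permutation of G,
   via f x = inv (h x). An involution has a square root as soon as it has no moved points or
   infinitely many: half of its 2-cycles can be matched with the other half, and each matched pair
   is the square of a 4-cycle. In an infinite group inversion cannot move a positive finite number
   of points: if it moved x but only finitely many points in total, then for all but finitely many
   t both t and x t would square to 1, so t would conjugate x to its inverse. Choosing t and s such
   that this holds for t, s and t s, the element t s would also centralize x, so x would be its own
   inverse. *)
theory Submission
  imports Defs
begin

text \<open>For infinite \<open>P\<close> the disjoint sum \<open>P <+> P\<close> is equipotent to
  \<open>P\<close>. A bijection between them carries the two summands to complementary halves of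
  \<open>P\<close>, each in bijection with \<open>P\<close>.\<close>

lemma infinite_split_equipotent:
  assumes "infinite P"
  obtains P1 P2 q where "P = P1 \<union> P2" "P1 \<inter> P2 = {}" "bij_betw q P1 P2"
proof -
  obtain \<phi> where \<phi>: "bij_betw \<phi> (P <+> P) P"
    using card_of_Plus_infinite1[OF assms card_of_mono1[OF subset_refl]]
      card_of_ordIso[of "P <+> P" P] by blast
  then have inj: "inj_on \<phi> (P <+> P)" and im: "\<phi> ` (P <+> P) = P"
    by (auto simp: bij_betw_def)
  have l: "bij_betw (\<phi> \<circ> Inl) P (\<phi> ` Inl ` P)" and r: "bij_betw (\<phi> \<circ> Inr) P (\<phi> ` Inr ` P)"
    using inj by (auto simp: bij_betw_def inj_on_def)
  show thesis
  proof
    show "P = \<phi> ` Inl ` P \<union> \<phi> ` Inr ` P"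
      using im unfolding Plus_def by blast
    show "\<phi> ` Inl ` P \<inter> \<phi> ` Inr ` P = {}"
      using inj by (auto simp: inj_on_def)
    show "bij_betw ((\<phi> \<circ> Inr) \<circ> inv_into P (\<phi> \<circ> Inl)) (\<phi> ` Inl ` P) (\<phi> ` Inr ` P)"
      using l r by (blast intro: bij_betw_trans bij_betw_inv_into)
  qed
qed

lemma free_involution_representatives:
  assumes "\<And>x. x \<in> S \<Longrightarrow> i x \<in> S" "\<And>x. x \<in> S \<Longrightarrow> i (i x) = x" "\<And>x. x \<in> S \<Longrightarrow> i x \<noteq> x"
  obtains P where "S = P \<union> i ` P" "P \<inter> i ` P = {}"
proof -
  \<comment> \<open>Choosing from the unordered pair makes \<open>c\<close> constant on orbits:
    \<open>x\<close> and \<open>i x\<close> yield the same set. So \<open>P\<close> below picks one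
    point of each 2-cycle.\<close>
  define c where "c x = (SOME y. y \<in> {x, i x})" for x
  have c: "c x \<in> {x, i x}" for x
    unfolding c_def by (rule someI[of _ x]) simp
  have c_inv: "c (i x) = c x" if "x \<in> S" for x
    using assms(2)[OF that] by (simp add: c_def insert_commute)
  define P where "P = {x \<in> S. c x = x}"
  show thesis
  proof
    show "S = P \<union> i ` P"
    proof
      show "P \<union> i ` P \<subseteq> S"
        using assms(1) by (auto simp: P_def)
      show "S \<subseteq> P \<union> i ` P"
      proof
        fix x assume x: "x \<in> S"
        show "x \<in> P \<union> i ` P"
        proof (cases "c x = x")
          case False
          then have "i x \<in> P"
            using c[of x] c_inv[OF x] x assms(1) by (auto simp: P_def)
          then have "i (i x) \<in> i ` P" by blast
          then show ?thesis using assms(2)[OF x] by simp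
        qed (use x in \<open>simp add: P_def\<close>)
      qed
    qed
    show "P \<inter> i ` P = {}"
      using c_inv assms(3) by (force simp: P_def)
  qed
qed

lemma free_involution_square_root:
  assumes "infinite S"
    and i: "\<And>x. x \<in> S \<Longrightarrow> i x \<in> S" "\<And>x. x \<in> S \<Longrightarrow> i (i x) = x" "\<And>x. x \<in> S \<Longrightarrow> i x \<noteq> x"
  obtains h where "\<And>x. x \<in> S \<Longrightarrow> h x \<in> S" "\<And>x. x \<in> S \<Longrightarrow> h (h x) = i x"
proof -
  obtain P where P: "S = P \<union> i ` P" "P \<inter> i ` P = {}"
    using free_involution_representatives[of S i] i by blast
  have "infinite P"
    using assms(1) P(1) by auto
  then obtain P1 P2 q where Q: "P = P1 \<union> P2" "P1 \<inter> P2 = {}" "bij_betw q P1 P2"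
    using infinite_split_equipotent by blast
  define r where "r = inv_into P1 q"
  have q: "q x \<in> P2" "r (q x) = x" if "x \<in> P1" for x
    using Q(3) that by (auto simp: r_def bij_betw_def)
  have r: "r x \<in> P1" "q (r x) = x" if "x \<in> P2" for x
    using Q(3) that by (auto simp: r_def bij_betw_def inv_into_into f_inv_into_f)
  have ii: "i (i x) = x" if "x \<in> P1 \<or> x \<in> P2" for x
    using that i(2) P(1) Q(1) by blast
  have not_P: "i x \<notin> P1" "i x \<notin> P2" if "x \<in> P1 \<or> x \<in> P2" for x
    using that P(2) Q(1) by blast+
  \<comment> \<open>For \<open>x\<close> in \<open>P1\<close>, \<open>h\<close> runs through the
    4-cycle \<open>x\<close>, \<open>q x\<close>, \<open>i x\<close>, \<open>i (q x)\<close>, whose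
    square swaps \<open>x\<close> with \<open>i x\<close> and \<open>q x\<close> with
    \<open>i (q x)\<close>. The four branches treat \<open>P1\<close>, \<open>P2\<close>,
    \<open>i\<close> P1\<open>and\<close>i \<open>P2\<close>.\<close>
  define h where "h x = (if x \<in> P1 then q x else if x \<in> P2 then i (r x)
    else if i x \<in> P1 then i (q (i x)) else r (i x))" for x
  have h: "h x = q x" "h (i x) = i (q x)" if "x \<in> P1" for x
    using that not_P[of x] ii[of x] by (auto simp: h_def)
  have h': "h x = i (r x)" "h (i x) = r x" if "x \<in> P2" for x
    using that Q(2) not_P[of x] ii[of x] by (auto simp: h_def)
  have S: "x \<in> S \<longleftrightarrow> x \<in> P1 \<or> x \<in> P2 \<or> x \<in> i ` P1 \<or> x \<in> i ` P2" for x
    using P(1) Q(1) by blast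
  show thesis
  proof
    fix x assume "x \<in> S"
    then consider "x \<in> P1" | "x \<in> P2" | y where "y \<in> P1" "x = i y" | y where "y \<in> P2" "x = i y"
      unfolding S by blast
    then have "h x \<in> S \<and> h (h x) = i x"
      by cases (simp_all add: S h h' q r ii)
    then show "h x \<in> S" "h (h x) = i x" by auto
  qed
qed

lemma involution_square_root:
  assumes i: "\<And>x. x \<in> A \<Longrightarrow> i x \<in> A" "\<And>x. x \<in> A \<Longrightarrow> i (i x) = x"
    and "{x \<in> A. i x \<noteq> x} = {} \<or> infinite {x \<in> A. i x \<noteq> x}"
  obtains h where "\<And>x. x \<in> A \<Longrightarrow> h x \<in> A" "\<And>x. x \<in> A \<Longrightarrow> h (h x) = i x"
  using assms(3)
proof
  assume "{x \<in> A. i x \<noteq> x} = {}"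
  then show thesis
    by (intro that[of "\<lambda>x. x"]) auto
next
  let ?S = "{x \<in> A. i x \<noteq> x}"
  assume "infinite ?S"
  moreover have "i x \<in> ?S" "i (i x) = x" "i x \<noteq> x" if "x \<in> ?S" for x
    using that i by auto
  ultimately obtain h where h: "\<And>x. x \<in> ?S \<Longrightarrow> h x \<in> ?S" "\<And>x. x \<in> ?S \<Longrightarrow> h (h x) = i x"
    using free_involution_square_root[of ?S i] by blast
  show thesis
  \<comment> \<open>The root on the moved points is extended by the identity on the fixed
    points.\<close>
  proof (rule that[of "\<lambda>x. if x \<in> ?S then h x else x"])
    fix x assume x: "x \<in> A"
    show "(if x \<in> ?S then h x else x) \<in> A"
      using h(1)[of x] x by auto
    show "(if (if x \<in> ?S then h x else x) \<in> ?S then h (if x \<in> ?S then h x else x)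
        else (if x \<in> ?S then h x else x)) = i x"
      using h[of x] x by (cases "x \<in> ?S") auto
  qed
qed

context group
begin

text \<open>Inverting the product gives
  \<open>x \<otimes> t = inv (x \<otimes> t) = t \<otimes> inv x\<close>; it remains to multiply by
  \<open>inv x\<close> on the left and by \<open>x\<close> on the right.\<close>

lemma conj_eq_inv:
  assumes x: "x \<in> carrier G" and t: "t \<in> carrier G" "inv t = t" "inv (x \<otimes> t) = x \<otimes> t"
  shows "t \<otimes> x = inv x \<otimes> t"
proof -
  have "t \<otimes> inv x = x \<otimes> t"
    using inv_mult_group[OF x t(1)] t by simp
  then have "inv x \<otimes> (x \<otimes> t) \<otimes> x = inv x \<otimes> (t \<otimes> inv x) \<otimes> x" by simp
  moreover have "inv x \<otimes> (x \<otimes> t) \<otimes> x = t \<otimes> x"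
    using x t(1) by (simp add: m_assoc[symmetric])
  moreover have "inv x \<otimes> (t \<otimes> inv x) \<otimes> x = inv x \<otimes> t"
    using x t(1) by (simp add: m_assoc)
  ultimately show ?thesis by simp
qed

lemma noninvolutions_empty_or_infinite:
  assumes "infinite (carrier G)"
  shows "{x \<in> carrier G. inv x \<noteq> x} = {} \<or> infinite {x \<in> carrier G. inv x \<noteq> x}"
proof (rule ccontr)
  let ?S = "{x \<in> carrier G. inv x \<noteq> x}"
  assume "\<not> ?thesis"
  then obtain x where fin: "finite ?S" and x: "x \<in> carrier G" "inv x \<noteq> x" by blast
  define B where "B = {t \<in> carrier G. t \<otimes> x \<noteq> inv x \<otimes> t}"
  \<comment> \<open>By \<open>conj_eq_inv\<close>, each \<open>t\<close> in \<open>B\<close> has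
    \<open>t\<close> or \<open>x \<otimes> t\<close> among the finitely many moved points.\<close>
  have "B \<subseteq> ?S \<union> (\<lambda>s. inv x \<otimes> s) ` ?S"
  proof
    fix t assume "t \<in> B"
    then have t: "t \<in> carrier G" "t \<otimes> x \<noteq> inv x \<otimes> t" by (auto simp: B_def)
    then have "inv t \<noteq> t \<or> inv (x \<otimes> t) \<noteq> x \<otimes> t"
      using conj_eq_inv x(1) by blast
    moreover have "t = inv x \<otimes> (x \<otimes> t)"
      using x(1) t(1) by (simp add: m_assoc[symmetric])
    ultimately show "t \<in> ?S \<union> (\<lambda>s. inv x \<otimes> s) ` ?S"
      using x(1) t(1) by blast
  qed
  then have finB: "finite B"
    using fin by (meson finite_Un finite_imageI finite_subset)
  obtain t where t: "t \<in> carrier G" "t \<notin> B"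
    using assms finB by (meson finite_subset subsetI)
  \<comment> \<open>Avoiding the translate of \<open>B\<close> by \<open>inv t\<close> keeps
    \<open>t \<otimes> s\<close> outside \<open>B\<close>.\<close>
  have "finite (B \<union> (\<lambda>s. inv t \<otimes> s) ` B)" using finB by simp
  then obtain s where s: "s \<in> carrier G" "s \<notin> B" "s \<notin> (\<lambda>s. inv t \<otimes> s) ` B"
    using assms by (meson UnCI finite_subset subsetI)
  have "s = inv t \<otimes> (t \<otimes> s)"
    using s(1) t(1) by (simp add: m_assoc[symmetric])
  then have ts: "t \<otimes> s \<notin> B"
    using s(3) by blast
  have inverts: "u \<otimes> x = inv x \<otimes> u" if "u \<in> carrier G" "u \<notin> B" for u
    using that by (auto simp: B_def)
  \<comment> \<open>Moving \<open>x\<close> across \<open>t\<close>, then across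
    \<open>t \<otimes> s\<close>, then across \<open>s\<close> replaces the inner \<open>x\<close>
    by \<open>inv x\<close>; cancelling \<open>t\<close> and \<open>s\<close> contradicts
    \<open>inv x \<noteq> x\<close>.\<close>
  have "t \<otimes> (x \<otimes> s) = inv x \<otimes> (t \<otimes> s)"
    using inverts[OF t] x(1) t(1) s(1) by (simp add: m_assoc[symmetric])
  also have "\<dots> = t \<otimes> (s \<otimes> x)"
    using inverts[OF _ ts] x(1) t(1) s(1) by (simp add: m_assoc)
  also have "\<dots> = t \<otimes> (inv x \<otimes> s)"
    using inverts[OF s(1,2)] by simp
  finally show False
    using x t(1) s(1) by simp
qed

end

text \<open>On the carrier the function is \<open>h\<close> applied three times, and
  \<open>h\<close> has fourth power the identity. So its inverse is \<open>h\<close>, and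
  \<open>h x\<close> is the group inverse of \<open>inv (h x)\<close>.\<close>

lemma inverse_ambiguous_of_square_root:
  assumes "group G"
    and h: "\<And>x. x \<in> carrier G \<Longrightarrow> h x \<in> carrier G"
      "\<And>x. x \<in> carrier G \<Longrightarrow> h (h x) = inv\<^bsub>G\<^esub> x"
  shows "inverse_ambiguous G (\<lambda>x. inv\<^bsub>G\<^esub> (h x))"
proof -
  interpret group G by fact
  let ?f = "\<lambda>x. inv\<^bsub>G\<^esub> (h x)"
  have fh: "?f (h x) = x" if "x \<in> carrier G" for x
    using h that by simp
  have inj: "inj_on ?f (carrier G)"
    by (intro inj_onI) (metis h inv_inv)
  have "?f ` carrier G = carrier G"
    using h(1) fh by (force simp: image_iff)
  moreover have "inv_into (carrier G) ?f x = inv\<^bsub>G\<^esub> (?f x)" if "x \<in> carrier G" for x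
    using inv_into_f_eq[OF inj h(1)[OF that] fh[OF that]] h(1)[OF that] by simp
  ultimately show ?thesis
    using inj by (simp add: inverse_ambiguous_def bij_betw_def)
qed

theorem theorem3p2:
  fixes G :: "('a, 'b) monoid_scheme"
  assumes "group G"
    and "infinite (carrier G)"
  shows "\<exists>f. inverse_ambiguous G f"
proof -
  interpret group G by fact
  obtain h where "\<And>x. x \<in> carrier G \<Longrightarrow> h x \<in> carrier G"
    "\<And>x. x \<in> carrier G \<Longrightarrow> h (h x) = inv\<^bsub>G\<^esub> x"
    using involution_square_root[of "carrier G" "\<lambda>x. inv\<^bsub>G\<^esub> x"]
      noninvolutions_empty_or_infinite[OF assms(2)] by auto
  then show ?thesis
    using inverse_ambiguous_of_square_root[OF assms(1)] by blast
qed

end
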